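(* Let $\Phi$ be a reduced crystallographic root system with Weyl group $W$, $A$ an algebra acted upon by $W$, $\{t_\alpha\}_{\alpha\in\Phi}\subset A$ elements such that $t_{-\alpha}=t_\alpha$, and $\tau:\mathfrak h\to A$ a linear map. Consider the $A$-valued connection on $H_{\mathrm{reg}}$ $$\nabla=d-\sum_{\alpha\in\Phi_+}\frac{d\alpha}{e^\alpha-1}\,t_\alpha-\sum_i du_i\,\tau(u^i).$$ (1) $\nabla$ is $W$-equivariant if and only if (a) $s_i(t_\alpha)=t_{s_i\alpha}$ and (b) $s_i(\tau(x))-\tau(s_ix)=\alpha_i(x)\,t_{\alpha_i}$ for any $\alpha\in\Phi$, any simple reflection $s_i\in W$ and any $x\in\mathfrak h$. (2) Modulo (a), the relation (b) is equivalent to the $W$-equivariance of the linear map $\delta:\mathfrak h\to A$ defined by $\delta(v)=\tau(v)-\frac12\sum_{\alpha\in\Phi_+}\alpha(v)\,t_\alpha$.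
   Context: $E$ is a Euclidean vector space, $\Phi\subset E^*$ a reduced crystallographic root system with Weyl group $W$, $\Phi_+$ a chosen system of positive roots, $\alpha_i$ the simple roots and $s_i=s_{\alpha_i}$ the simple reflections. $P\subset E^*$ is the weight lattice (dual to the lattice generated by the coroots), $H=\mathrm{Hom}_{\mathbb Z}(P,\mathbb C^* )$ the torus with Lie algebra $\mathfrak h=\mathrm{Hom}_{\mathbb Z}(P,\mathbb C)$; $e^\lambda\in\mathbb C[H]$ is the function corresponding to $\lambda\in P$; $H_{\mathrm{reg}}=H\setminus\bigcup_{\alpha\in\Phi}\{e^\alpha=1\}$. $A$ is an associative algebra over $\mathbb C$ on which $W$ acts by algebra automorphisms. $\{u_i\},\{u^i\}$ are dual bases of $\mathfrak h^*$ and $\mathfrak h$; $du_i$ are translation-invariant one-forms on $H$. Writing $\nabla=d-\omega$, $\nabla$ is $W$-equivariant if $\omega$ is invariant under the simultaneous action of each $w\in W$ on $A$ and on forms on $H_{\mathrm{reg}}$ by $(w^{-1})^*$ (so that $e^\lambda\mapsto e^{w\lambda}$, $d\lambda\mapsto d(w\lambda)$). *)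

theory Defs
  imports "HOL-Analysis.Analysis" "HOL-Library.Function_Algebras"
begin

section \<open>Root systems\<close>

text \<open>
  The type \<open>'e\<close> plays the role of the dual \<open>E\<^sup>*\<close> of the Euclidean space, with its induced inner
  product; \<open>E\<close> is identified with it through the inner product, so that the coroot of \<open>\<alpha>\<close> is
  \<open>2\<alpha> / (\<alpha> \<bullet> \<alpha>)\<close>. Finite dimensionality is a consequence of the finite spanning set \<open>\<Phi>\<close>.
\<close>

definition reflection :: "'e::real_inner \<Rightarrow> 'e \<Rightarrow> 'e" where
  "reflection \<alpha> x = x - (2 * (x \<bullet> \<alpha>) / (\<alpha> \<bullet> \<alpha>)) *\<^sub>R \<alpha>"

definition reduced_root_system :: "'e::real_inner set \<Rightarrow> bool" where
  "reduced_root_system \<Phi> \<longleftrightarrow>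
     finite \<Phi> \<and> 0 \<notin> \<Phi> \<and> span \<Phi> = UNIV \<and>
     (\<forall>\<alpha>\<in>\<Phi>. reflection \<alpha> ` \<Phi> = \<Phi>) \<and>
     (\<forall>\<alpha>\<in>\<Phi>. \<forall>\<beta>\<in>\<Phi>. 2 * (\<beta> \<bullet> \<alpha>) / (\<alpha> \<bullet> \<alpha>) \<in> \<int>) \<and>
     (\<forall>\<alpha>\<in>\<Phi>. \<forall>c::real. c *\<^sub>R \<alpha> \<in> \<Phi> \<longrightarrow> c = 1 \<or> c = - 1)"

text \<open>Reflections are involutions, so closure under composition suffices for the generated group.\<close>

inductive_set weyl_group :: "'e::real_inner set \<Rightarrow> ('e \<Rightarrow> 'e) set" for \<Phi> where
  weyl_id: "id \<in> weyl_group \<Phi>"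
| weyl_reflection: "\<alpha> \<in> \<Phi> \<Longrightarrow> w \<in> weyl_group \<Phi> \<Longrightarrow> reflection \<alpha> \<circ> w \<in> weyl_group \<Phi>"

definition positive_system :: "'e::real_inner set \<Rightarrow> 'e set \<Rightarrow> bool" where
  "positive_system \<Phi> \<Phi>p \<longleftrightarrow>
     (\<exists>\<gamma>. (\<forall>\<alpha>\<in>\<Phi>. \<gamma> \<bullet> \<alpha> \<noteq> 0) \<and> \<Phi>p = {\<alpha>\<in>\<Phi>. \<gamma> \<bullet> \<alpha> > 0})"

definition simple_roots :: "'e::real_inner set \<Rightarrow> 'e set" where
  "simple_roots \<Phi>p = {\<alpha>\<in>\<Phi>p. \<not> (\<exists>\<beta>\<in>\<Phi>p. \<exists>\<gamma>\<in>\<Phi>p. \<alpha> = \<beta> + \<gamma>)}"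

definition weight_lattice :: "'e::real_inner set \<Rightarrow> 'e set" where
  "weight_lattice \<Phi> = {\<mu>. \<forall>\<alpha>\<in>\<Phi>. 2 * (\<mu> \<bullet> \<alpha>) / (\<alpha> \<bullet> \<alpha>) \<in> \<int>}"


section \<open>The torus and its Lie algebra\<close>

text \<open>
  A map defined on the weight lattice \<open>P\<close> is represented by the function on \<open>'e\<close> that agrees with it
  on \<open>P\<close> and is \<open>0\<close> off \<open>P\<close>. The operations of the torus and of its Lie algebra are then
  the pointwise product and sum of functions.
\<close>

definition torus :: "'e::real_inner set \<Rightarrow> ('e \<Rightarrow> complex) set" where
  "torus \<Phi> = {h. (\<forall>\<mu>\<in>weight_lattice \<Phi>. h \<mu> \<noteq> 0) \<and>
     (\<forall>\<mu>\<in>weight_lattice \<Phi>. \<forall>\<nu>\<in>weight_lattice \<Phi>. h (\<mu> + \<nu>) = h \<mu> * h \<nu>) \<and>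
     (\<forall>\<mu>. \<mu> \<notin> weight_lattice \<Phi> \<longrightarrow> h \<mu> = 0)}"

definition torus_lie :: "'e::real_inner set \<Rightarrow> ('e \<Rightarrow> complex) set" where
  "torus_lie \<Phi> = {x.
     (\<forall>\<mu>\<in>weight_lattice \<Phi>. \<forall>\<nu>\<in>weight_lattice \<Phi>. x (\<mu> + \<nu>) = x \<mu> + x \<nu>) \<and>
     (\<forall>\<mu>. \<mu> \<notin> weight_lattice \<Phi> \<longrightarrow> x \<mu> = 0)}"

definition fun_scale :: "complex \<Rightarrow> ('e \<Rightarrow> complex) \<Rightarrow> 'e \<Rightarrow> complex" where
  "fun_scale c x = (\<lambda>\<mu>. c * x \<mu>)"

global_interpretation cfun: vector_space "fun_scale :: complex \<Rightarrow> ('e \<Rightarrow> complex) \<Rightarrow> 'e \<Rightarrow> complex"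
  defines cfun_span = cfun.span
    and cfun_dependent = cfun.dependent
  by unfold_locales (auto simp: fun_scale_def algebra_simps)

definition torus_char :: "'e \<Rightarrow> ('e \<Rightarrow> complex) \<Rightarrow> complex" where
  "torus_char \<mu> h = h \<mu>"

text \<open>A weight \<open>\<mu>\<close> as a linear form on the Lie algebra.\<close>

definition weight_form :: "'e \<Rightarrow> ('e \<Rightarrow> complex) \<Rightarrow> complex" where
  "weight_form \<mu> x = x \<mu>"

definition torus_reg :: "'e::real_inner set \<Rightarrow> ('e \<Rightarrow> complex) set" where
  "torus_reg \<Phi> = {h \<in> torus \<Phi>. \<forall>\<alpha>\<in>\<Phi>. torus_char \<alpha> h \<noteq> 1}"

text \<open>
  The action of \<open>w \<in> W\<close> on the torus and on its Lie algebra dual to the action on weights.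
  It keeps functions vanishing off \<open>P\<close> in that class because \<open>w\<close> preserves \<open>P\<close>.
\<close>

definition weyl_act :: "('e \<Rightarrow> 'e) \<Rightarrow> ('e \<Rightarrow> complex) \<Rightarrow> 'e \<Rightarrow> complex" where
  "weyl_act w f = (\<lambda>\<nu>. f (inv w \<nu>))"

definition dual_bases ::
  "'e::real_inner set \<Rightarrow> 'i set \<Rightarrow> ('i \<Rightarrow> ('e \<Rightarrow> complex) \<Rightarrow> complex) \<Rightarrow> ('i \<Rightarrow> 'e \<Rightarrow> complex) \<Rightarrow> bool"
where
  "dual_bases \<Phi> I ul uu \<longleftrightarrow>
     finite I \<and> inj_on uu I \<and>
     \<not> cfun_dependent (uu ` I) \<and> cfun_span (uu ` I) = torus_lie \<Phi> \<and>
     (\<forall>i\<in>I. \<forall>x\<in>torus_lie \<Phi>. \<forall>y\<in>torus_lie \<Phi>. ul i (x + y) = ul i x + ul i y) \<and>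
     (\<forall>i\<in>I. \<forall>c. \<forall>x\<in>torus_lie \<Phi>. ul i (fun_scale c x) = c * ul i x) \<and>
     (\<forall>i\<in>I. \<forall>j\<in>I. ul i (uu j) = (if i = j then 1 else 0))"


section \<open>Algebras with an action of the Weyl group\<close>

text \<open>No unit is required, and a unit is automatically preserved by automorphisms.\<close>

locale complex_algebra = vector_space smul
  for smul :: "complex \<Rightarrow> 'a::ring \<Rightarrow> 'a" +
  assumes smul_mult_left: "smul c x * y = smul c (x * y)"
    and smul_mult_right: "x * smul c y = smul c (x * y)"

text \<open>Bijectivity of each \<open>act w\<close> follows, since the elements of \<open>W\<close> are invertible in \<open>W\<close>.\<close>

definition acts_by_algebra_automorphisms ::
  "('e \<Rightarrow> 'e) set \<Rightarrow> (complex \<Rightarrow> 'a::ring \<Rightarrow> 'a) \<Rightarrow> (('e \<Rightarrow> 'e) \<Rightarrow> 'a \<Rightarrow> 'a) \<Rightarrow> bool"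
where
  "acts_by_algebra_automorphisms W smul act \<longleftrightarrow>
     (\<forall>a. act id a = a) \<and>
     (\<forall>w\<in>W. \<forall>w'\<in>W. \<forall>a. act (w \<circ> w') a = act w (act w' a)) \<and>
     (\<forall>w\<in>W. \<forall>a b. act w (a + b) = act w a + act w b) \<and>
     (\<forall>w\<in>W. \<forall>a b. act w (a * b) = act w a * act w b) \<and>
     (\<forall>w\<in>W. \<forall>c a. act w (smul c a) = smul c (act w a))"

definition linear_on_torus_lie ::
  "'e::real_inner set \<Rightarrow> (complex \<Rightarrow> 'a::ring \<Rightarrow> 'a) \<Rightarrow> (('e \<Rightarrow> complex) \<Rightarrow> 'a) \<Rightarrow> bool"
where
  "linear_on_torus_lie \<Phi> smul f \<longleftrightarrow>
     (\<forall>x\<in>torus_lie \<Phi>. \<forall>y\<in>torus_lie \<Phi>. f (x + y) = f x + f y) \<and>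
     (\<forall>c. \<forall>x\<in>torus_lie \<Phi>. f (fun_scale c x) = smul c (f x))"

definition W_equivariant_map ::
  "'e::real_inner set \<Rightarrow> (('e \<Rightarrow> 'e) \<Rightarrow> 'a \<Rightarrow> 'a) \<Rightarrow> (('e \<Rightarrow> complex) \<Rightarrow> 'a) \<Rightarrow> bool"
where
  "W_equivariant_map \<Phi> act f \<longleftrightarrow>
     (\<forall>w\<in>weyl_group \<Phi>. \<forall>x\<in>torus_lie \<Phi>. act w (f x) = f (weyl_act w x))"


section \<open>One-forms and the connection\<close>

text \<open>
  The tangent bundle of the torus is trivialised by translations, so that a one-form with values in
  \<open>'b\<close> is given by its value at a point \<open>h\<close> of the torus on a tangent vector \<open>v\<close> in the Lie algebra.
\<close>

type_synonym ('e, 'b) one_form = "('e \<Rightarrow> complex) \<Rightarrow> ('e \<Rightarrow> complex) \<Rightarrow> 'b"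

definition invariant_form :: "(('e \<Rightarrow> complex) \<Rightarrow> complex) \<Rightarrow> ('e, complex) one_form" where
  "invariant_form u = (\<lambda>h v. u v)"

text \<open>
  The pullback of a one-form along the automorphism \<open>weyl_act w\<close> of the torus. In the
  trivialisation by translations the differential of this automorphism is \<open>weyl_act w\<close> on the Lie
  algebra; see the lemma \<open>weyl_act_curve\<close> below.
\<close>

definition pullback :: "('e \<Rightarrow> 'e) \<Rightarrow> ('e, 'b) one_form \<Rightarrow> ('e, 'b) one_form" where
  "pullback w \<omega> = (\<lambda>h v. \<omega> (weyl_act w h) (weyl_act w v))"

text \<open>Simultaneous action of \<open>w\<close> on values and, through \<open>(w\<^sup>-\<^sup>1)\<^sup>*\<close>, on forms.\<close>

definition form_act ::
  "(('e \<Rightarrow> 'e) \<Rightarrow> 'a \<Rightarrow> 'a) \<Rightarrow> ('e \<Rightarrow> 'e) \<Rightarrow> ('e, 'a) one_form \<Rightarrow> ('e, 'a) one_form"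
where
  "form_act act w \<omega> = (\<lambda>h v. act w (pullback (inv w) \<omega> h v))"

text \<open>The form \<open>\<omega>\<close> of the connection \<open>\<nabla> = d - \<omega>\<close>.\<close>

definition connection_form ::
  "'e set \<Rightarrow> (complex \<Rightarrow> 'a::ring \<Rightarrow> 'a) \<Rightarrow> ('e \<Rightarrow> 'a) \<Rightarrow> (('e \<Rightarrow> complex) \<Rightarrow> 'a) \<Rightarrow>
   'i set \<Rightarrow> ('i \<Rightarrow> ('e \<Rightarrow> complex) \<Rightarrow> complex) \<Rightarrow> ('i \<Rightarrow> 'e \<Rightarrow> complex) \<Rightarrow> ('e, 'a) one_form"
where
  "connection_form \<Phi>p smul t \<tau> I ul uu = (\<lambda>h v.
     (\<Sum>\<alpha>\<in>\<Phi>p. smul (invariant_form (weight_form \<alpha>) h v / (torus_char \<alpha> h - 1)) (t \<alpha>)) +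
     (\<Sum>i\<in>I. smul (invariant_form (ul i) h v) (\<tau> (uu i))))"

text \<open>The \<open>W\<close>-equivariance of \<open>d - \<omega>\<close> on the regular part of the torus.\<close>

definition W_equivariant_connection ::
  "'e::real_inner set \<Rightarrow> (('e \<Rightarrow> 'e) \<Rightarrow> 'a \<Rightarrow> 'a) \<Rightarrow> ('e, 'a) one_form \<Rightarrow> bool"
where
  "W_equivariant_connection \<Phi> act \<omega> \<longleftrightarrow>
     (\<forall>w\<in>weyl_group \<Phi>. \<forall>h\<in>torus_reg \<Phi>. \<forall>v\<in>torus_lie \<Phi>. form_act act w \<omega> h v = \<omega> h v)"

definition delta_map ::
  "'e set \<Rightarrow> (complex \<Rightarrow> 'a::ring \<Rightarrow> 'a) \<Rightarrow> ('e \<Rightarrow> 'a) \<Rightarrow> (('e \<Rightarrow> complex) \<Rightarrow> 'a) \<Rightarrow>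
   ('e \<Rightarrow> complex) \<Rightarrow> 'a"
where
  "delta_map \<Phi>p smul t \<tau> v =
     \<tau> v - smul (1/2) (\<Sum>\<alpha>\<in>\<Phi>p. smul (weight_form \<alpha> v) (t \<alpha>))"


section \<open>Checks of the conventions\<close>

lemma reflection_reflection [simp]: "reflection \<alpha> (reflection \<alpha> x) = x"
proof (cases "\<alpha> = 0")
  case False
  then show ?thesis
    by (simp add: reflection_def inner_diff_left algebra_simps)
qed (simp add: reflection_def)

lemma bij_reflection: "bij (reflection \<alpha>)"
  by (metis bijI' reflection_reflection)

lemma weyl_bij: "w \<in> weyl_group \<Phi> \<Longrightarrow> bij w"
  by (induction rule: weyl_group.induct) (simp_all only: bij_id bij_comp bij_reflection)

text \<open>The action on functions sends \<open>e\<^sup>\<mu>\<close> to \<open>e\<^bsup>w\<mu>\<^esup>\<close>, and on one-forms \<open>d\<mu>\<close> to \<open>d(w\<mu>)\<close>.\<close>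

lemma torus_char_act:
  "w \<in> weyl_group \<Phi> \<Longrightarrow> torus_char \<mu> (weyl_act (inv w) h) = torus_char (w \<mu>) h"
  by (simp add: torus_char_def weyl_act_def inv_inv_eq weyl_bij)

lemma pullback_weight_form:
  "w \<in> weyl_group \<Phi> \<Longrightarrow>
     pullback (inv w) (invariant_form (weight_form \<mu>)) = invariant_form (weight_form (w \<mu>))"
  by (simp add: pullback_def invariant_form_def weight_form_def weyl_act_def inv_inv_eq weyl_bij)

lemma reflection_weight_lattice:
  assumes \<Phi>: "reduced_root_system \<Phi>" and \<alpha>: "\<alpha> \<in> \<Phi>" and \<mu>: "\<mu> \<in> weight_lattice \<Phi>"
  shows "reflection \<alpha> \<mu> \<in> weight_lattice \<Phi>"
  unfolding weight_lattice_def
proof safe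
  fix \<beta> assume \<beta>: "\<beta> \<in> \<Phi>"
  have "2 * (reflection \<alpha> \<mu> \<bullet> \<beta>) / (\<beta> \<bullet> \<beta>)
      = 2 * (\<mu> \<bullet> \<beta>) / (\<beta> \<bullet> \<beta>) - (2 * (\<mu> \<bullet> \<alpha>) / (\<alpha> \<bullet> \<alpha>)) * (2 * (\<alpha> \<bullet> \<beta>) / (\<beta> \<bullet> \<beta>))"
    by (simp add: reflection_def inner_diff_left diff_divide_distrib algebra_simps)
  also have "\<dots> \<in> \<int>"
    using \<Phi> \<alpha> \<beta> \<mu> unfolding reduced_root_system_def weight_lattice_def
    by (intro Ints_diff Ints_mult) auto
  finally show "2 * (reflection \<alpha> \<mu> \<bullet> \<beta>) / (\<beta> \<bullet> \<beta>) \<in> \<int>" .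
qed

lemma weyl_weight_lattice:
  assumes \<Phi>: "reduced_root_system \<Phi>" and w: "w \<in> weyl_group \<Phi>"
  shows "w \<mu> \<in> weight_lattice \<Phi> \<longleftrightarrow> \<mu> \<in> weight_lattice \<Phi>"
  using w
proof (induction arbitrary: \<mu>)
  case (weyl_reflection \<alpha> w)
  then show ?case
    by (metis \<Phi> comp_apply reflection_reflection reflection_weight_lattice)
qed simp

definition torus_exp :: "'e::real_inner set \<Rightarrow> ('e \<Rightarrow> complex) \<Rightarrow> 'e \<Rightarrow> complex" where
  "torus_exp \<Phi> x = (\<lambda>\<mu>. if \<mu> \<in> weight_lattice \<Phi> then exp (x \<mu>) else 0)"

text \<open>
  The curve \<open>s \<mapsto> h exp(s v)\<close> with tangent vector \<open>v\<close> at \<open>h\<close> is sent by \<open>w\<close> to the curve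
  with tangent vector \<open>w v\<close> at \<open>w h\<close>.
\<close>

lemma weyl_act_curve:
  assumes \<Phi>: "reduced_root_system \<Phi>" and w: "w \<in> weyl_group \<Phi>"
  shows "weyl_act w (h * torus_exp \<Phi> (fun_scale s v))
       = weyl_act w h * torus_exp \<Phi> (fun_scale s (weyl_act w v))"
proof -
  have "inv w \<nu> \<in> weight_lattice \<Phi> \<longleftrightarrow> \<nu> \<in> weight_lattice \<Phi>" for \<nu>
    using weyl_weight_lattice[OF \<Phi> w, of "inv w \<nu>"] weyl_bij[OF w]
    by (simp add: bij_is_surj surj_f_inv_f)
  then show ?thesis
    by (auto simp: weyl_act_def torus_exp_def fun_scale_def fun_eq_iff)
qed

end

theory Submission
  imports Defs
begin

text \<open>
  Write \<open>s = s\<^sub>\<beta>\<close> for a simple root \<open>\<beta>\<close>. It permutes the positive roots other than \<open>\<beta>\<close> and sends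
  \<open>\<beta>\<close> to \<open>-\<beta>\<close>, and \<open>-1 / (e\<^bsup>-\<beta>\<^esup> - 1) = 1 / (e\<^sup>\<beta> - 1) + 1\<close>. Hence the form \<open>\<omega>\<close> of the connection
  and its transform \<open>s \<omega>\<close> differ, on a tangent vector \<open>v\<close>, by
  \[
    \sum_{\alpha > 0} \frac{\alpha(v)}{e^\alpha - 1} (s(t_{s\alpha}) - t_\alpha)
      + \beta(v) s(t_\beta) + s(\tau(s v)) - \tau(v).
  \]
  Relation (a) makes the sum vanish, and then the remaining constant vanishes for all \<open>v\<close> exactly
  when (b) holds for \<open>\<beta>\<close>. Conversely, the functions \<open>1 / (e\<^sup>\<alpha> - 1)\<close>, with \<open>\<alpha>\<close> positive, have poles
  along different divisors, because the root system is reduced: a curve that approaches a generic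
  point of \<open>e\<^sup>\<alpha> = 1\<close> isolates the coefficient of \<open>1 / (e\<^sup>\<alpha> - 1)\<close> (lemma
  \<open>polar_coefficients_zero\<close>). So the vanishing of the displayed expression forces (a), and then (b).

  For (2), the same permutation property gives, under (a),
  \<open>s(\<delta>(x)) - \<delta>(s x) = s(\<tau>(x)) - \<tau>(s x) - \<beta>(x) t\<^sub>\<beta>\<close>.

  Both parts then need that the simple reflections generate the Weyl group (lemma
  \<open>weyl_group_simple_roots\<close>). This and the permutation property are proved directly from the
  description of the simple roots as the indecomposable positive roots.
\<close>

section \<open>Simple reflections\<close>

lemma reflection_isometry: "reflection \<alpha> x \<bullet> reflection \<alpha> y = x \<bullet> y"
  by (cases "\<alpha> = 0")
    (simp_all add: reflection_def inner_diff_left inner_diff_right inner_commute field_simps)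

lemma reflection_self [simp]: "reflection \<alpha> \<alpha> = - \<alpha>"
  by (cases "\<alpha> = 0") (simp_all add: reflection_def scaleR_2)

lemma reflection_minus_left [simp]: "reflection (- \<alpha>) = reflection \<alpha>"
  by (simp add: reflection_def fun_eq_iff)

lemma reflection_minus_right [simp]: "reflection \<alpha> (- x) = - reflection \<alpha> x"
  by (simp add: reflection_def)

lemma reflection_diff: "reflection \<alpha> (x - y) = reflection \<alpha> x - reflection \<alpha> y"
  by (simp add: reflection_def inner_diff_left algebra_simps diff_divide_distrib)

lemma inv_reflection [simp]: "inv (reflection \<alpha>) = reflection \<alpha>"
  by (rule inv_equality) simp_all

lemma reflection_conjugate:
  "reflection \<beta> \<circ> (reflection (reflection \<beta> \<alpha>) \<circ> reflection \<beta>) = reflection \<alpha>"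
proof
  fix x
  have "reflection \<beta> x \<bullet> reflection \<beta> \<alpha> = x \<bullet> \<alpha>" "reflection \<beta> \<alpha> \<bullet> reflection \<beta> \<alpha> = \<alpha> \<bullet> \<alpha>"
    by (rule reflection_isometry)+
  moreover have "reflection \<beta> (y - c *\<^sub>R z) = reflection \<beta> y - c *\<^sub>R reflection \<beta> z" for c y z
    by (simp add: reflection_def algebra_simps diff_divide_distrib)
  ultimately show "(reflection \<beta> \<circ> (reflection (reflection \<beta> \<alpha>) \<circ> reflection \<beta>)) x = reflection \<alpha> x"
    by (simp add: reflection_def [of "reflection \<beta> \<alpha>"] reflection_def [of \<alpha>])
qed

lemma reflection_in_weyl_group: "\<alpha> \<in> \<Phi> \<Longrightarrow> reflection \<alpha> \<in> weyl_group \<Phi>"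
  using weyl_reflection [OF _ weyl_id] by simp

lemma weyl_group_comp:
  assumes "w \<in> weyl_group S" "w' \<in> weyl_group S"
  shows "w \<circ> w' \<in> weyl_group S"
  using assms(1)
proof induction
  case (weyl_reflection \<alpha> w)
  then show ?case
    unfolding comp_assoc by (intro weyl_group.weyl_reflection)
qed (use assms in simp)

text \<open>A reduced crystallographic root system with a choice of positive roots.\<close>

locale positive_root_system =
  fixes \<Phi> \<Phi>p :: "'e::real_inner set"
  assumes root_system: "reduced_root_system \<Phi>"
    and positive: "positive_system \<Phi> \<Phi>p"
begin

lemma finite_roots: "finite \<Phi>"
  and zero_not_root: "0 \<notin> \<Phi>"
  and Cartan_integer: "\<alpha> \<in> \<Phi> \<Longrightarrow> \<beta> \<in> \<Phi> \<Longrightarrow> 2 * (\<beta> \<bullet> \<alpha>) / (\<alpha> \<bullet> \<alpha>) \<in> \<int>"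
  and reduced: "\<alpha> \<in> \<Phi> \<Longrightarrow> c *\<^sub>R \<alpha> \<in> \<Phi> \<Longrightarrow> c = 1 \<or> c = - 1"
  using root_system by (auto simp: reduced_root_system_def)

lemma reflection_root: "\<alpha> \<in> \<Phi> \<Longrightarrow> \<beta> \<in> \<Phi> \<Longrightarrow> reflection \<alpha> \<beta> \<in> \<Phi>"
  using root_system unfolding reduced_root_system_def by blast

lemma minus_root: "\<alpha> \<in> \<Phi> \<Longrightarrow> - \<alpha> \<in> \<Phi>"
  using reflection_root [of \<alpha> \<alpha>] by simp

lemma root_inner_pos: "\<alpha> \<in> \<Phi> \<Longrightarrow> \<alpha> \<bullet> \<alpha> > 0"
  using zero_not_root by (metis inner_gt_zero_iff)

lemma root_weight: "\<alpha> \<in> \<Phi> \<Longrightarrow> \<alpha> \<in> weight_lattice \<Phi>"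
  by (simp add: weight_lattice_def Cartan_integer)

text \<open>A regular vector that defines the positive roots.\<close>

definition height_vector :: 'e where
  "height_vector = (SOME \<gamma>. (\<forall>\<alpha>\<in>\<Phi>. \<gamma> \<bullet> \<alpha> \<noteq> 0) \<and> \<Phi>p = {\<alpha>\<in>\<Phi>. \<gamma> \<bullet> \<alpha> > 0})"

lemma height_vector_regular: "\<alpha> \<in> \<Phi> \<Longrightarrow> height_vector \<bullet> \<alpha> \<noteq> 0"
  and positive_iff: "\<alpha> \<in> \<Phi>p \<longleftrightarrow> \<alpha> \<in> \<Phi> \<and> height_vector \<bullet> \<alpha> > 0"
proof -
  have "(\<forall>\<alpha>\<in>\<Phi>. height_vector \<bullet> \<alpha> \<noteq> 0) \<and> \<Phi>p = {\<alpha>\<in>\<Phi>. height_vector \<bullet> \<alpha> > 0}"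
    unfolding height_vector_def by (rule someI_ex) (use positive in \<open>simp add: positive_system_def\<close>)
  then show "\<alpha> \<in> \<Phi> \<Longrightarrow> height_vector \<bullet> \<alpha> \<noteq> 0"
    and "\<alpha> \<in> \<Phi>p \<longleftrightarrow> \<alpha> \<in> \<Phi> \<and> height_vector \<bullet> \<alpha> > 0"
    by blast+
qed

lemma positive_root: "\<alpha> \<in> \<Phi>p \<Longrightarrow> \<alpha> \<in> \<Phi>"
  by (simp add: positive_iff)

lemma finite_positive: "finite \<Phi>p"
  using finite_roots positive_root by (meson finite_subset subsetI)

lemma minus_positive: "\<alpha> \<in> \<Phi>p \<Longrightarrow> - \<alpha> \<notin> \<Phi>p"
  by (simp add: positive_iff)

lemma positive_or_negative: "\<alpha> \<in> \<Phi> \<Longrightarrow> \<alpha> \<in> \<Phi>p \<or> - \<alpha> \<in> \<Phi>p"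
  using height_vector_regular [of \<alpha>] by (auto simp: positive_iff minus_root)

lemma simple_positive: "\<beta> \<in> simple_roots \<Phi>p \<Longrightarrow> \<beta> \<in> \<Phi>p"
  by (simp add: simple_roots_def)

lemma simple_root: "\<beta> \<in> simple_roots \<Phi>p \<Longrightarrow> \<beta> \<in> \<Phi>"
  by (simp add: simple_positive positive_root)

lemma proportional_root:
  assumes "\<alpha> \<in> \<Phi>" "\<beta> \<in> \<Phi>" "\<alpha> = c *\<^sub>R \<beta>"
  shows "\<alpha> = \<beta> \<or> \<alpha> = - \<beta>"
  using reduced [of \<beta> c] assms by auto

text \<open>
  Induction on the value of the height vector, which need not be an integer; it is well-founded
  because there are finitely many positive roots.
\<close>

lemma positive_induct [consumes 1, case_names less]:
  assumes "\<alpha> \<in> \<Phi>p"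
    and step: "\<And>\<alpha>. \<alpha> \<in> \<Phi>p \<Longrightarrow>
      (\<And>\<beta>. \<beta> \<in> \<Phi>p \<Longrightarrow> height_vector \<bullet> \<beta> < height_vector \<bullet> \<alpha> \<Longrightarrow> P \<beta>) \<Longrightarrow> P \<alpha>"
  shows "P \<alpha>"
  using \<open>\<alpha> \<in> \<Phi>p\<close>
proof (induction "card {\<beta> \<in> \<Phi>p. height_vector \<bullet> \<beta> < height_vector \<bullet> \<alpha>}"
    arbitrary: \<alpha> rule: less_induct)
  case less
  show ?case
  proof (rule step [OF less.prems])
    fix \<beta> assume \<beta>: "\<beta> \<in> \<Phi>p" "height_vector \<bullet> \<beta> < height_vector \<bullet> \<alpha>"
    then have "{\<gamma> \<in> \<Phi>p. height_vector \<bullet> \<gamma> < height_vector \<bullet> \<beta>}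
        \<subset> {\<gamma> \<in> \<Phi>p. height_vector \<bullet> \<gamma> < height_vector \<bullet> \<alpha>}"
      by auto
    then have "card {\<gamma> \<in> \<Phi>p. height_vector \<bullet> \<gamma> < height_vector \<bullet> \<beta>}
        < card {\<gamma> \<in> \<Phi>p. height_vector \<bullet> \<gamma> < height_vector \<bullet> \<alpha>}"
      by (intro psubset_card_mono) (simp_all add: finite_positive)
    then show "P \<beta>"
      using less.hyps \<beta>(1) by blast
  qed
qed

text \<open>
  The two Cartan integers of \<open>\<alpha>\<close> and \<open>\<beta>\<close> are positive and cannot both exceed \<open>1\<close>; whichever is
  \<open>1\<close>, the corresponding reflection gives \<open>\<alpha> - \<beta>\<close> up to sign.
\<close>

lemma root_difference:
  assumes \<alpha>: "\<alpha> \<in> \<Phi>" and \<beta>: "\<beta> \<in> \<Phi>" and pos: "\<alpha> \<bullet> \<beta> > 0" and neq: "\<alpha> \<noteq> \<beta>"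
  shows "\<alpha> - \<beta> \<in> \<Phi>"
proof -
  have aa: "\<alpha> \<bullet> \<alpha> > 0" and bb: "\<beta> \<bullet> \<beta> > 0"
    using \<alpha> \<beta> root_inner_pos by auto
  obtain m where m: "2 * (\<alpha> \<bullet> \<beta>) / (\<beta> \<bullet> \<beta>) = of_int m"
    using Cartan_integer [OF \<beta> \<alpha>] by (auto elim: Ints_cases)
  obtain n where n: "2 * (\<beta> \<bullet> \<alpha>) / (\<alpha> \<bullet> \<alpha>) = of_int n"
    using Cartan_integer [OF \<alpha> \<beta>] by (auto elim: Ints_cases)
  have "of_int m > (0::real)" "of_int n > (0::real)"
    using pos aa bb by (simp_all flip: m n add: inner_commute)
  then have mn_pos: "m > 0" "n > 0"
    by simp_all
  have "m = 1 \<or> n = 1"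
  proof (rule ccontr)
    assume "\<not> (m = 1 \<or> n = 1)"
    then have "2 \<le> m" "2 \<le> n"
      using mn_pos by auto
    then have "of_int m \<ge> (2::real)" "of_int n \<ge> (2::real)"
      by simp_all
    then have ge: "\<alpha> \<bullet> \<beta> \<ge> \<beta> \<bullet> \<beta>" "\<alpha> \<bullet> \<beta> \<ge> \<alpha> \<bullet> \<alpha>"
      using aa bb by (simp_all flip: m n add: field_simps inner_commute)
    then have "(\<alpha> - \<beta>) \<bullet> (\<alpha> - \<beta>) \<le> 0"
      by (simp add: inner_diff_left inner_diff_right inner_commute)
    then have "(\<alpha> - \<beta>) \<bullet> (\<alpha> - \<beta>) = 0"
      by (intro antisym inner_ge_zero)
    then show False
      using neq by simp
  qed
  then show ?thesis
  proof
    assume "m = 1"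
    then have "reflection \<beta> \<alpha> = \<alpha> - \<beta>"
      unfolding reflection_def m by simp
    then show ?thesis
      using reflection_root [OF \<beta> \<alpha>] by simp
  next
    assume "n = 1"
    then have "reflection \<alpha> \<beta> = \<beta> - \<alpha>"
      unfolding reflection_def n by simp
    then show ?thesis
      using minus_root [OF reflection_root [OF \<alpha> \<beta>]] by simp
  qed
qed

lemma positive_minus_simple:
  assumes "\<beta> \<in> simple_roots \<Phi>p" "\<alpha> \<in> \<Phi>p" "\<alpha> - \<beta> \<in> \<Phi>"
  shows "\<alpha> - \<beta> \<in> \<Phi>p"
proof (rule ccontr)
  assume "\<alpha> - \<beta> \<notin> \<Phi>p"
  then have "\<beta> - \<alpha> \<in> \<Phi>p"
    using positive_or_negative [OF assms(3)] by simp
  moreover have "\<beta> = \<alpha> + (\<beta> - \<alpha>)"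
    by simp
  ultimately show False
    using assms(1,2) unfolding simple_roots_def by blast
qed

text \<open>
  The induction runs down the \<open>\<beta>\<close>-string through \<open>\<alpha>\<close>: each subtraction of \<open>\<beta>\<close> keeps a root
  positive, for otherwise \<open>\<beta>\<close> would decompose.
\<close>

lemma simple_reflection_positive:
  assumes \<beta>: "\<beta> \<in> simple_roots \<Phi>p" and "\<alpha> \<in> \<Phi>p" "\<alpha> \<noteq> \<beta>"
  shows "reflection \<beta> \<alpha> \<in> \<Phi>p"
proof -
  have \<beta>p: "\<beta> \<in> \<Phi>p" and \<beta>\<Phi>: "\<beta> \<in> \<Phi>"
    using \<beta> simple_positive simple_root by auto
  have bb: "\<beta> \<bullet> \<beta> > 0"
    using \<beta>\<Phi> by (rule root_inner_pos)
  obtain k where "2 * (\<alpha> \<bullet> \<beta>) / (\<beta> \<bullet> \<beta>) = of_int k"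
    using Cartan_integer [OF \<beta>\<Phi> positive_root [OF \<open>\<alpha> \<in> \<Phi>p\<close>]] by (auto elim: Ints_cases)
  then show ?thesis
    using \<open>\<alpha> \<in> \<Phi>p\<close> \<open>\<alpha> \<noteq> \<beta>\<close>
  proof (induction "nat k" arbitrary: \<alpha> k rule: less_induct)
    case less
    note k = less.prems(1) and \<alpha>p = less.prems(2)
    have \<alpha>\<Phi>: "\<alpha> \<in> \<Phi>"
      using \<alpha>p by (rule positive_root)
    have refl\<Phi>: "reflection \<beta> \<alpha> \<in> \<Phi>"
      by (rule reflection_root [OF \<beta>\<Phi> \<alpha>\<Phi>])
    have refl: "reflection \<beta> \<alpha> = \<alpha> - of_int k *\<^sub>R \<beta>"
      by (simp add: reflection_def k)
    consider "k \<le> 0" | "k = 1" | "k \<ge> 2"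
      by linarith
    then show ?case
    proof cases
      case 1
      then have "of_int k * (height_vector \<bullet> \<beta>) \<le> 0"
        using \<beta>p by (simp add: positive_iff mult_le_0_iff)
      moreover have "height_vector \<bullet> \<alpha> > 0"
        using \<alpha>p by (simp add: positive_iff)
      ultimately have "height_vector \<bullet> reflection \<beta> \<alpha> > 0"
        by (simp add: refl inner_diff_right)
      then show ?thesis
        using refl\<Phi> by (simp add: positive_iff)
    next
      case 2
      then show ?thesis
        using positive_minus_simple [OF \<beta> \<alpha>p] refl refl\<Phi> by simp
    next
      case 3
      then have "of_int k > (0::real)"
        by simp
      then have "\<alpha> \<bullet> \<beta> > 0"
        using bb by (simp flip: k add: zero_less_divide_iff)
      then have "\<alpha> - \<beta> \<in> \<Phi>"
        using root_difference [OF \<alpha>\<Phi> \<beta>\<Phi>] less.prems(3) by simp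
      then have diff: "\<alpha> - \<beta> \<in> \<Phi>p"
        by (rule positive_minus_simple [OF \<beta> \<alpha>p])
      have "\<alpha> - \<beta> \<noteq> \<beta>"
      proof
        assume "\<alpha> - \<beta> = \<beta>"
        then have "\<alpha> = 2 *\<^sub>R \<beta>"
          by (simp add: scaleR_2 algebra_simps)
        then show False
          using reduced [OF \<beta>\<Phi>, of 2] \<alpha>\<Phi> by simp
      qed
      moreover have "2 * ((\<alpha> - \<beta>) \<bullet> \<beta>) / (\<beta> \<bullet> \<beta>) = of_int (k - 2)"
        using k bb by (simp add: inner_diff_left field_simps)
      ultimately have "reflection \<beta> (\<alpha> - \<beta>) \<in> \<Phi>p"
        using less.hyps [of "k - 2" "\<alpha> - \<beta>"] diff 3 by simp
      moreover have "reflection \<beta> (\<alpha> - \<beta>) - \<beta> = reflection \<beta> \<alpha>"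
        by (simp add: reflection_diff)
      ultimately show ?thesis
        using positive_minus_simple [OF \<beta>, of "reflection \<beta> (\<alpha> - \<beta>)"] refl\<Phi> by simp
    qed
  qed
qed

lemma sum_positive_reflection:
  fixes F :: "'e \<Rightarrow> 'b::ab_group_add"
  assumes \<beta>: "\<beta> \<in> simple_roots \<Phi>p"
  shows "(\<Sum>\<alpha>\<in>\<Phi>p. F (reflection \<beta> \<alpha>)) = (\<Sum>\<alpha>\<in>\<Phi>p. F \<alpha>) + F (- \<beta>) - F \<beta>"
proof -
  have \<beta>p: "\<beta> \<in> \<Phi>p"
    using \<beta> by (rule simple_positive)
  have maps: "reflection \<beta> \<alpha> \<in> \<Phi>p - {\<beta>}" if "\<alpha> \<in> \<Phi>p - {\<beta>}" for \<alpha>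
  proof -
    have "reflection \<beta> \<alpha> \<noteq> \<beta>"
      using that \<beta>p minus_positive [of \<beta>] by (metis DiffD1 reflection_reflection reflection_self)
    then show ?thesis
      using that simple_reflection_positive [OF \<beta>] by simp
  qed
  have "(\<Sum>\<alpha>\<in>\<Phi>p - {\<beta>}. F (reflection \<beta> \<alpha>)) = (\<Sum>\<alpha>\<in>\<Phi>p - {\<beta>}. F \<alpha>)"
    by (rule sum.reindex_bij_witness [of _ "reflection \<beta>" "reflection \<beta>"]) (use maps in auto)
  then show ?thesis
    using \<beta>p finite_positive by (simp add: sum.remove [where x = \<beta>])
qed

text \<open>
  This replaces the expansion of a positive root as a nonnegative combination of simple roots: the
  root is decomposed repeatedly, keeping a summand with positive inner product.
\<close>

lemma simple_root_inner_pos: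
  assumes "\<alpha> \<in> \<Phi>p" "x \<bullet> \<alpha> > 0"
  shows "\<exists>\<beta>\<in>simple_roots \<Phi>p. x \<bullet> \<beta> > 0"
  using assms
proof (induction rule: positive_induct)
  case (less \<alpha>)
  show ?case
  proof (cases "\<alpha> \<in> simple_roots \<Phi>p")
    case False
    then obtain \<beta> \<gamma> where sum: "\<beta> \<in> \<Phi>p" "\<gamma> \<in> \<Phi>p" "\<alpha> = \<beta> + \<gamma>"
      using less.hyps by (auto simp: simple_roots_def)
    then have "height_vector \<bullet> \<beta> < height_vector \<bullet> \<alpha>" "height_vector \<bullet> \<gamma> < height_vector \<bullet> \<alpha>"
      by (simp_all add: positive_iff inner_add_right)
    moreover have "x \<bullet> \<beta> > 0 \<or> x \<bullet> \<gamma> > 0"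
      using less.prems sum by (auto simp: inner_add_right)
    ultimately show ?thesis
      using less.IH sum by blast
  qed (use less.prems in blast)
qed

text \<open>
  A positive root that is not simple has positive inner product with some simple root \<open>\<beta>\<close>, and
  \<open>s\<^sub>\<beta>\<close> then sends it to a positive root of smaller height.
\<close>

lemma reflection_in_simple_group:
  assumes "\<alpha> \<in> \<Phi>p"
  shows "reflection \<alpha> \<in> weyl_group (simple_roots \<Phi>p)"
  using assms
proof (induction rule: positive_induct)
  case (less \<alpha>)
  show ?case
  proof (cases "\<alpha> \<in> simple_roots \<Phi>p")
    case True
    then show ?thesis
      by (rule reflection_in_weyl_group)
  next
    case False
    have "\<alpha> \<bullet> \<alpha> > 0"
      using less.hyps by (intro root_inner_pos positive_root)
    then obtain \<beta> where \<beta>: "\<beta> \<in> simple_roots \<Phi>p" "\<alpha> \<bullet> \<beta> > 0"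
      using simple_root_inner_pos less.hyps by blast
    let ?\<gamma> = "reflection \<beta> \<alpha>"
    have "\<alpha> \<noteq> \<beta>"
      using False \<beta> by blast
    then have "?\<gamma> \<in> \<Phi>p"
      by (rule simple_reflection_positive [OF \<beta>(1) less.hyps])
    moreover have "height_vector \<bullet> ?\<gamma> < height_vector \<bullet> \<alpha>"
    proof -
      have "\<beta> \<bullet> \<beta> > 0" "height_vector \<bullet> \<beta> > 0"
        using simple_positive [OF \<beta>(1)] by (simp_all only: positive_iff root_inner_pos)
      then show ?thesis
        using \<beta>(2) by (simp add: reflection_def inner_diff_right)
    qed
    ultimately have \<gamma>: "reflection ?\<gamma> \<in> weyl_group (simple_roots \<Phi>p)"
      by (rule less.IH)
    have "reflection \<beta> \<circ> (reflection ?\<gamma> \<circ> reflection \<beta>) \<in> weyl_group (simple_roots \<Phi>p)"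
      by (intro weyl_group_comp \<gamma> reflection_in_weyl_group [OF \<beta>(1)])
    then show ?thesis
      by (simp add: reflection_conjugate)
  qed
qed

lemma weyl_group_simple_roots: "weyl_group (simple_roots \<Phi>p) = weyl_group \<Phi>"
proof (rule subset_antisym; rule subsetI)
  fix w assume "w \<in> weyl_group (simple_roots \<Phi>p)"
  then show "w \<in> weyl_group \<Phi>"
    by induction (intro weyl_group.intros simple_root; assumption)+
next
  fix w assume "w \<in> weyl_group \<Phi>"
  then show "w \<in> weyl_group (simple_roots \<Phi>p)"
  proof induction
    case (weyl_reflection \<alpha> w)
    have "reflection \<alpha> \<in> weyl_group (simple_roots \<Phi>p)"
      using positive_or_negative [OF weyl_reflection.hyps(1)]
        reflection_in_simple_group [of \<alpha>] reflection_in_simple_group [of "- \<alpha>"] by auto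
    then show ?case
      using weyl_reflection.IH by (rule weyl_group_comp)
  qed (rule weyl_id)
qed

end

section \<open>Independence of the polar parts\<close>

lemma exists_not_orthogonal:
  fixes S :: "'e::real_inner set"
  assumes "finite S" "0 \<notin> S"
  shows "\<exists>\<xi>. \<forall>x\<in>S. \<xi> \<bullet> x \<noteq> 0"
  using assms
proof (induction S)
  case (insert x S)
  then obtain \<xi> where \<xi>: "\<forall>y\<in>S. \<xi> \<bullet> y \<noteq> 0"
    by auto
  \<comment> \<open>Each \<open>y\<close> is orthogonal to \<open>\<xi> + c x\<close> for at most one \<open>c\<close>.\<close>
  have "finite ((\<lambda>y. - (\<xi> \<bullet> y) / (x \<bullet> y)) ` insert x S)"
    using insert.hyps by simp
  then obtain c where c: "c \<notin> (\<lambda>y. - (\<xi> \<bullet> y) / (x \<bullet> y)) ` insert x S"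
    using ex_new_if_finite [OF infinite_UNIV_char_0] by blast
  have "(\<xi> + c *\<^sub>R x) \<bullet> y \<noteq> 0" if y: "y \<in> insert x S" for y
  proof (cases "x \<bullet> y = 0")
    case True
    then have "y \<in> S"
      using y insert.prems by auto
    then show ?thesis
      using True \<xi> by (simp add: inner_add_left)
  next
    case False
    moreover have "c \<noteq> - (\<xi> \<bullet> y) / (x \<bullet> y)"
      using c y by blast
    ultimately show ?thesis
      by (auto simp: inner_add_left field_simps add_eq_0_iff)
  qed
  then show ?case
    by blast
qed simp

lemma weight_lattice_add:
  "\<mu> \<in> weight_lattice \<Phi> \<Longrightarrow> \<nu> \<in> weight_lattice \<Phi> \<Longrightarrow> \<mu> + \<nu> \<in> weight_lattice \<Phi>"
  by (auto simp: weight_lattice_def inner_add_left distrib_left add_divide_distrib)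

text \<open>The element of the Lie algebra given by pairing weights with the real vector \<open>\<xi>\<close>.\<close>

definition real_lie :: "'e::real_inner set \<Rightarrow> 'e \<Rightarrow> 'e \<Rightarrow> complex" where
  "real_lie \<Phi> \<xi> = (\<lambda>\<mu>. if \<mu> \<in> weight_lattice \<Phi> then of_real (\<xi> \<bullet> \<mu>) else 0)"

lemma real_lie_in_torus_lie: "real_lie \<Phi> \<xi> \<in> torus_lie \<Phi>"
  by (auto simp: real_lie_def torus_lie_def weight_lattice_add inner_add_right)

lemma torus_exp_in_torus: "x \<in> torus_lie \<Phi> \<Longrightarrow> torus_exp \<Phi> x \<in> torus \<Phi>"
  by (auto simp: torus_exp_def torus_def torus_lie_def weight_lattice_add exp_add)

context positive_root_system
begin

lemma torus_exp_real_lie: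
  "\<alpha> \<in> \<Phi> \<Longrightarrow> torus_exp \<Phi> (real_lie \<Phi> \<xi>) \<alpha> = of_real (exp (\<xi> \<bullet> \<alpha>))"
  by (simp add: torus_exp_def real_lie_def root_weight exp_of_real)

lemma torus_exp_real_lie_regular:
  assumes "\<And>\<alpha>. \<alpha> \<in> \<Phi> \<Longrightarrow> \<xi> \<bullet> \<alpha> \<noteq> 0"
  shows "torus_exp \<Phi> (real_lie \<Phi> \<xi>) \<in> torus_reg \<Phi>"
  using assms
  by (simp add: torus_reg_def torus_exp_in_torus real_lie_in_torus_lie torus_char_def
      torus_exp_real_lie)

lemma torus_reg_nonempty: "\<exists>h. h \<in> torus_reg \<Phi>"
  using torus_exp_real_lie_regular [OF height_vector_regular] by blast

lemma exists_generic_wall_vector: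
  assumes \<beta>: "\<beta> \<in> \<Phi>"
  shows "\<exists>\<xi>. \<xi> \<bullet> \<beta> = 0 \<and> (\<forall>\<alpha>\<in>\<Phi> - {\<beta>, - \<beta>}. \<xi> \<bullet> \<alpha> \<noteq> 0)"
proof -
  have bb: "\<beta> \<bullet> \<beta> > 0"
    using \<beta> by (rule root_inner_pos)
  define proj where "proj x = x - ((x \<bullet> \<beta>) / (\<beta> \<bullet> \<beta>)) *\<^sub>R \<beta>" for x
  have "proj \<alpha> \<noteq> 0" if "\<alpha> \<in> \<Phi> - {\<beta>, - \<beta>}" for \<alpha>
    using proportional_root [of \<alpha> \<beta> "(\<alpha> \<bullet> \<beta>) / (\<beta> \<bullet> \<beta>)"] that \<beta> by (auto simp: proj_def)
  then have "0 \<notin> proj ` (\<Phi> - {\<beta>, - \<beta>})"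
    by force
  then obtain \<xi> where \<xi>: "\<forall>x\<in>proj ` (\<Phi> - {\<beta>, - \<beta>}). \<xi> \<bullet> x \<noteq> 0"
    using exists_not_orthogonal [of "proj ` (\<Phi> - {\<beta>, - \<beta>})"] finite_roots by auto
  have "proj \<xi> \<bullet> \<beta> = 0"
    using bb by (simp add: proj_def inner_diff_left)
  moreover have "proj \<xi> \<bullet> \<alpha> = \<xi> \<bullet> proj \<alpha>" for \<alpha>
    by (simp add: proj_def inner_diff_left inner_diff_right inner_commute)
  ultimately show ?thesis
    using \<xi> by (intro exI [of _ "proj \<xi>"]) simp
qed

text \<open>
  The curve \<open>s \<mapsto> exp(\<xi> + s \<beta>)\<close>, with \<open>\<xi>\<close> generic on the wall of \<open>\<beta>\<close>, is regular for small
  \<open>s \<noteq> 0\<close>. Multiplying the relation by \<open>e\<^sup>\<beta> - 1\<close> along it and letting \<open>s\<close> tend to \<open>0\<close> leaves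
  the coefficient at \<open>\<beta>\<close>.
\<close>

lemma scalar_polar_coefficients_zero:
  fixes c :: "'e \<Rightarrow> complex"
  assumes rel: "\<And>h. h \<in> torus_reg \<Phi> \<Longrightarrow> (\<Sum>\<alpha>\<in>\<Phi>p. c \<alpha> / (h \<alpha> - 1)) + c0 = 0"
    and \<beta>: "\<beta> \<in> \<Phi>p"
  shows "c \<beta> = 0"
proof -
  have \<beta>\<Phi>: "\<beta> \<in> \<Phi>"
    using \<beta> by (rule positive_root)
  have bb: "\<beta> \<bullet> \<beta> > 0"
    using \<beta>\<Phi> by (rule root_inner_pos)
  obtain \<xi> where \<xi>: "\<xi> \<bullet> \<beta> = 0" "\<And>\<alpha>. \<alpha> \<in> \<Phi> - {\<beta>, - \<beta>} \<Longrightarrow> \<xi> \<bullet> \<alpha> \<noteq> 0"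
    using exists_generic_wall_vector [OF \<beta>\<Phi>] by blast
  define e where "e \<alpha> s = complex_of_real (exp ((\<xi> + s *\<^sub>R \<beta>) \<bullet> \<alpha>))" for \<alpha> s
  have lim: "(e \<alpha> \<longlongrightarrow> of_real (exp (\<xi> \<bullet> \<alpha>))) (at 0)" for \<alpha>
    unfolding e_def by (auto intro!: tendsto_eq_intros)
  have regular: "\<forall>\<^sub>F s in at 0. \<forall>\<alpha>\<in>\<Phi>. (\<xi> + s *\<^sub>R \<beta>) \<bullet> \<alpha> \<noteq> 0"
  proof (rule eventually_ball_finite [OF finite_roots], rule ballI)
    fix \<alpha> assume \<alpha>: "\<alpha> \<in> \<Phi>"
    show "\<forall>\<^sub>F s in at 0. (\<xi> + s *\<^sub>R \<beta>) \<bullet> \<alpha> \<noteq> 0"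
    proof (cases "\<alpha> \<in> {\<beta>, - \<beta>}")
      case True
      then show ?thesis
        using \<xi>(1) bb zero_not_root \<beta>\<Phi>
        by (auto simp: inner_add_left eventually_at_filter)
    next
      case False
      have "((\<lambda>s. (\<xi> + s *\<^sub>R \<beta>) \<bullet> \<alpha>) \<longlongrightarrow> \<xi> \<bullet> \<alpha>) (at 0)"
        by (auto intro!: tendsto_eq_intros)
      then show ?thesis
        using \<xi>(2) [of \<alpha>] False \<alpha> by (intro tendsto_imp_eventually_ne) auto
    qed
  qed
  let ?G = "\<lambda>s. (\<Sum>\<alpha>\<in>\<Phi>p. c \<alpha> * ((e \<beta> s - 1) / (e \<alpha> s - 1))) + c0 * (e \<beta> s - 1)"
  have "\<forall>\<^sub>F s in at 0. ?G s = 0"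
    using regular
  proof eventually_elim
    case (elim s)
    then have reg: "torus_exp \<Phi> (real_lie \<Phi> (\<xi> + s *\<^sub>R \<beta>)) \<in> torus_reg \<Phi>"
      by (intro torus_exp_real_lie_regular) auto
    have "(\<Sum>\<alpha>\<in>\<Phi>p. c \<alpha> / (torus_exp \<Phi> (real_lie \<Phi> (\<xi> + s *\<^sub>R \<beta>)) \<alpha> - 1))
        = (\<Sum>\<alpha>\<in>\<Phi>p. c \<alpha> / (e \<alpha> s - 1))"
      by (intro sum.cong) (simp_all add: torus_exp_real_lie positive_root e_def)
    then have "(\<Sum>\<alpha>\<in>\<Phi>p. c \<alpha> / (e \<alpha> s - 1)) + c0 = 0"
      using rel [OF reg] by simp
    then have "(e \<beta> s - 1) * ((\<Sum>\<alpha>\<in>\<Phi>p. c \<alpha> / (e \<alpha> s - 1)) + c0) = 0"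
      by simp
    then show "?G s = 0"
      by (simp add: distrib_left sum_distrib_left mult.commute)
  qed
  then have "(?G \<longlongrightarrow> 0) (at 0)"
    by (rule tendsto_eventually)
  moreover have "(?G \<longlongrightarrow> (\<Sum>\<alpha>\<in>\<Phi>p. c \<alpha> * (if \<alpha> = \<beta> then 1 else 0)) + c0 * (1 - 1)) (at 0)"
  proof (intro tendsto_add tendsto_sum tendsto_mult tendsto_const tendsto_diff)
    show lim\<beta>: "(e \<beta> \<longlongrightarrow> 1) (at 0)"
      using lim [of \<beta>] \<xi>(1) by simp
    fix \<alpha> assume \<alpha>: "\<alpha> \<in> \<Phi>p"
    show "((\<lambda>s. (e \<beta> s - 1) / (e \<alpha> s - 1)) \<longlongrightarrow> (if \<alpha> = \<beta> then 1 else 0)) (at 0)"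
    proof (cases "\<alpha> = \<beta>")
      case True
      have "\<forall>\<^sub>F s in at 0. (e \<beta> s - 1) / (e \<beta> s - 1) = 1"
        using regular by eventually_elim (use \<beta>\<Phi> in \<open>auto simp: e_def\<close>)
      then show ?thesis
        using True by (simp add: tendsto_eventually)
    next
      case False
      then have "\<xi> \<bullet> \<alpha> \<noteq> 0"
        using \<xi>(2) [of \<alpha>] \<alpha> \<beta> minus_positive positive_root by auto
      then have "((\<lambda>s. (e \<beta> s - 1) / (e \<alpha> s - 1))
          \<longlongrightarrow> (1 - 1) / (of_real (exp (\<xi> \<bullet> \<alpha>)) - 1)) (at 0)"
        by (intro tendsto_divide tendsto_diff tendsto_const lim lim\<beta>) simp
      then show ?thesis
        using False by simp
    qed
  qed
  ultimately have "0 = (\<Sum>\<alpha>\<in>\<Phi>p. c \<alpha> * (if \<alpha> = \<beta> then 1 else 0)) + c0 * (1 - 1)"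
    by (intro tendsto_unique [OF at_neq_bot])
  then show ?thesis
    using \<beta> finite_positive by (simp add: if_distrib sum.delta cong: if_cong)
qed

end

lemma (in vector_space) exists_dual_vector:
  assumes "x \<noteq> 0"
  obtains f where "Vector_Spaces.linear scale (*) f" "f x = 1"
proof -
  interpret functionals: vector_space_pair scale "(*) :: 'a \<Rightarrow> 'a \<Rightarrow> 'a"
    by unfold_locales (simp_all add: algebra_simps)
  have "independent {x}"
    using assms by simp
  then obtain f where "Vector_Spaces.linear scale (*) f" "\<forall>y\<in>{x}. f y = 1"
    using functionals.linear_independent_extend [of "{x}" "\<lambda>_. 1"] by blast
  then show thesis
    using that by simp
qed

text \<open>The algebra carries no topology, so the limit is taken after applying a linear functional.\<close>

lemma (in positive_root_system) polar_coefficients_zero: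
  fixes smul :: "complex \<Rightarrow> 'a::ab_group_add \<Rightarrow> 'a"
  assumes "vector_space smul"
    and rel: "\<And>h. h \<in> torus_reg \<Phi> \<Longrightarrow> (\<Sum>\<alpha>\<in>\<Phi>p. smul (1 / (h \<alpha> - 1)) (a \<alpha>)) + a0 = 0"
    and \<beta>: "\<beta> \<in> \<Phi>p"
  shows "a \<beta> = 0"
proof (rule ccontr)
  assume "a \<beta> \<noteq> 0"
  then obtain f where f: "Vector_Spaces.linear smul (*) f" "f (a \<beta>) = 1"
    using vector_space.exists_dual_vector [OF assms(1)] by blast
  interpret f: Vector_Spaces.linear smul "(*)" f
    by (rule f(1))
  have "(\<Sum>\<alpha>\<in>\<Phi>p. f (a \<alpha>) / (h \<alpha> - 1)) + f a0 = 0" if "h \<in> torus_reg \<Phi>" for h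
    using arg_cong [OF rel [OF that], of f] by (simp add: f.add f.sum f.scale f.zero)
  then have "f (a \<beta>) = 0"
    using scalar_polar_coefficients_zero [of "\<lambda>\<alpha>. f (a \<alpha>)" "f a0"] \<beta> by blast
  then show False
    using f(2) by simp
qed

section \<open>The Weyl group action on the torus and its Lie algebra\<close>

lemma reflection_add: "reflection \<alpha> (x + y) = reflection \<alpha> x + reflection \<alpha> y"
  by (simp add: reflection_def inner_add_left algebra_simps add_divide_distrib)

lemma weyl_act_reflection: "weyl_act (reflection \<beta>) f \<mu> = f (reflection \<beta> \<mu>)"
  by (simp add: weyl_act_def)

lemma weyl_act_reflection_twice [simp]: "weyl_act (reflection \<beta>) (weyl_act (reflection \<beta>) f) = f"
  by (simp add: weyl_act_def)

lemma weyl_act_id [simp]: "weyl_act id f = f"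
  by (simp add: weyl_act_def)

lemma weyl_act_comp: "bij w \<Longrightarrow> bij w' \<Longrightarrow> weyl_act (w \<circ> w') f = weyl_act w (weyl_act w' f)"
  by (simp add: weyl_act_def o_inv_distrib)

lemma torus_lie_add: "x \<in> torus_lie \<Phi> \<Longrightarrow> y \<in> torus_lie \<Phi> \<Longrightarrow> x + y \<in> torus_lie \<Phi>"
  by (simp add: torus_lie_def)

lemma torus_lie_scale: "x \<in> torus_lie \<Phi> \<Longrightarrow> fun_scale c x \<in> torus_lie \<Phi>"
  by (simp add: torus_lie_def fun_scale_def distrib_left)

lemma torus_lie_zero: "0 \<in> torus_lie \<Phi>"
  by (simp add: torus_lie_def)

lemma weight_lattice_zero: "0 \<in> weight_lattice \<Phi>"
  by (simp add: weight_lattice_def)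

lemma weight_lattice_minus: "\<mu> \<in> weight_lattice \<Phi> \<Longrightarrow> - \<mu> \<in> weight_lattice \<Phi>"
  by (simp add: weight_lattice_def)

lemma torus_lie_minus:
  assumes "x \<in> torus_lie \<Phi>" "\<mu> \<in> weight_lattice \<Phi>"
  shows "x (- \<mu>) = - x \<mu>"
proof -
  have "x (0 + 0) = x 0 + x 0" "x (\<mu> + - \<mu>) = x \<mu> + x (- \<mu>)"
    using assms weight_lattice_zero weight_lattice_minus unfolding torus_lie_def by blast+
  then show ?thesis
    by (simp add: eq_neg_iff_add_eq_0 add.commute)
qed

lemma torus_minus:
  assumes "h \<in> torus \<Phi>" "\<mu> \<in> weight_lattice \<Phi>"
  shows "h (- \<mu>) = 1 / h \<mu>"
proof -
  have "h (0 + 0) = h 0 * h 0" "h (\<mu> + - \<mu>) = h \<mu> * h (- \<mu>)" "h 0 \<noteq> 0" "h \<mu> \<noteq> 0"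
    using assms weight_lattice_zero weight_lattice_minus unfolding torus_def by blast+
  then show ?thesis
    by (simp add: field_simps)
qed

context positive_root_system
begin

lemma reflection_weight_iff:
  "\<beta> \<in> \<Phi> \<Longrightarrow> reflection \<beta> \<mu> \<in> weight_lattice \<Phi> \<longleftrightarrow> \<mu> \<in> weight_lattice \<Phi>"
  by (rule weyl_weight_lattice [OF root_system reflection_in_weyl_group])

lemma reflection_torus_lie:
  "\<beta> \<in> \<Phi> \<Longrightarrow> x \<in> torus_lie \<Phi> \<Longrightarrow> weyl_act (reflection \<beta>) x \<in> torus_lie \<Phi>"
  by (simp add: torus_lie_def weyl_act_reflection reflection_add reflection_weight_iff)

lemma reflection_torus_reg:
  "\<beta> \<in> \<Phi> \<Longrightarrow> h \<in> torus_reg \<Phi> \<Longrightarrow> weyl_act (reflection \<beta>) h \<in> torus_reg \<Phi>"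
  by (simp add: torus_reg_def torus_def torus_char_def weyl_act_reflection reflection_add
      reflection_weight_iff reflection_root)

lemma weyl_torus_lie:
  assumes "w \<in> weyl_group \<Phi>" "x \<in> torus_lie \<Phi>"
  shows "weyl_act w x \<in> torus_lie \<Phi>"
  using assms(1)
  by induction (use assms(2) in
    \<open>simp_all only: weyl_act_id weyl_act_comp bij_reflection weyl_bij reflection_torus_lie\<close>)

end

section \<open>Equivariance under a simple reflection\<close>

text \<open>
  The dual bases enter the connection only through \<open>\<Sum>\<^sub>i u\<^sub>i(v) \<tau>(u\<^sup>i) = \<tau>(v)\<close>.
\<close>

lemma dual_bases_sum:
  fixes smul :: "complex \<Rightarrow> 'a::ring \<Rightarrow> 'a"
  assumes "vector_space smul" and \<tau>: "linear_on_torus_lie \<Phi> smul \<tau>"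
    and bases: "dual_bases \<Phi> I ul uu" and v: "v \<in> torus_lie \<Phi>"
  shows "(\<Sum>i\<in>I. smul (ul i v) (\<tau> (uu i))) = \<tau> v"
proof -
  interpret vector_space smul
    by (rule assms(1))
  have fin: "finite I" and span: "cfun_span (uu ` I) = torus_lie \<Phi>"
    and ul_add: "\<And>i x y. i \<in> I \<Longrightarrow> x \<in> torus_lie \<Phi> \<Longrightarrow> y \<in> torus_lie \<Phi> \<Longrightarrow> ul i (x + y) = ul i x + ul i y"
    and ul_scale: "\<And>i c x. i \<in> I \<Longrightarrow> x \<in> torus_lie \<Phi> \<Longrightarrow> ul i (fun_scale c x) = c * ul i x"
    and dual: "\<And>i j. i \<in> I \<Longrightarrow> j \<in> I \<Longrightarrow> ul i (uu j) = (if i = j then 1 else 0)"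
    using bases by (auto simp: dual_bases_def)
  have \<tau>_add: "\<And>x y. x \<in> torus_lie \<Phi> \<Longrightarrow> y \<in> torus_lie \<Phi> \<Longrightarrow> \<tau> (x + y) = \<tau> x + \<tau> y"
    and \<tau>_scale: "\<And>c x. x \<in> torus_lie \<Phi> \<Longrightarrow> \<tau> (fun_scale c x) = smul c (\<tau> x)"
    using \<tau> by (auto simp: linear_on_torus_lie_def)
  let ?D = "{x \<in> torus_lie \<Phi>. (\<Sum>i\<in>I. smul (ul i x) (\<tau> (uu i))) = \<tau> x}"
  have scale_D: "fun_scale c x \<in> ?D" if "x \<in> ?D" for c x
    using that by (auto simp: torus_lie_scale ul_scale \<tau>_scale simp flip: scale_sum_right scale_scale)
  have "fun_scale 0 0 = (0 :: 'b \<Rightarrow> complex)"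
    by (simp add: fun_scale_def fun_eq_iff)
  then have "0 \<in> ?D"
    using ul_scale [OF _ torus_lie_zero, of _ 0] \<tau>_scale [OF torus_lie_zero, of 0]
    by (simp add: torus_lie_zero)
  moreover have "x + y \<in> ?D" if "x \<in> ?D" "y \<in> ?D" for x y
    using that by (auto simp: torus_lie_add ul_add \<tau>_add scale_left_distrib sum.distrib)
  ultimately have "cfun.subspace ?D"
    using scale_D by (intro cfun.subspaceI)
  moreover have "uu ` I \<subseteq> ?D"
  proof safe
    fix j assume j: "j \<in> I"
    then show "uu j \<in> torus_lie \<Phi>"
      using cfun.span_base [of "uu j" "uu ` I"] span by simp
    have "(\<Sum>i\<in>I. smul (ul i (uu j)) (\<tau> (uu i))) = (\<Sum>i\<in>I. if i = j then \<tau> (uu i) else 0)"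
      using j by (intro sum.cong) (simp_all add: dual)
    then show "(\<Sum>i\<in>I. smul (ul i (uu j)) (\<tau> (uu i))) = \<tau> (uu j)"
      using j fin by simp
  qed
  ultimately have "cfun_span (uu ` I) \<subseteq> ?D"
    by (intro cfun.span_minimal)
  then show ?thesis
    using v span by blast
qed

text \<open>The data of the connection, apart from the dual bases.\<close>

locale weyl_algebra = positive_root_system \<Phi> \<Phi>p + complex_algebra smul
  for \<Phi> \<Phi>p :: "'e::real_inner set" and smul :: "complex \<Rightarrow> 'a::ring \<Rightarrow> 'a" +
  fixes act :: "('e \<Rightarrow> 'e) \<Rightarrow> 'a \<Rightarrow> 'a" and t :: "'e \<Rightarrow> 'a" and \<tau> :: "('e \<Rightarrow> complex) \<Rightarrow> 'a"
  assumes action: "acts_by_algebra_automorphisms (weyl_group \<Phi>) smul act"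
    and t_minus: "\<And>\<alpha>. \<alpha> \<in> \<Phi> \<Longrightarrow> t (- \<alpha>) = t \<alpha>"
    and \<tau>_linear: "linear_on_torus_lie \<Phi> smul \<tau>"
begin

lemma act_id: "act id a = a"
  and act_comp: "w \<in> weyl_group \<Phi> \<Longrightarrow> w' \<in> weyl_group \<Phi> \<Longrightarrow> act (w \<circ> w') a = act w (act w' a)"
  and act_add: "w \<in> weyl_group \<Phi> \<Longrightarrow> act w (a + b) = act w a + act w b"
  and act_scale: "w \<in> weyl_group \<Phi> \<Longrightarrow> act w (smul c a) = smul c (act w a)"
  using action by (simp_all add: acts_by_algebra_automorphisms_def)

lemma act_zero: "w \<in> weyl_group \<Phi> \<Longrightarrow> act w 0 = 0"
  using act_add [of w 0 0] by simp

lemma act_diff: "w \<in> weyl_group \<Phi> \<Longrightarrow> act w (a - b) = act w a - act w b"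
  using act_add [of w "a - b" b] by (simp add: algebra_simps)

lemma act_sum: "w \<in> weyl_group \<Phi> \<Longrightarrow> act w (\<Sum>k\<in>K. f k) = (\<Sum>k\<in>K. act w (f k))"
  by (induction K rule: infinite_finite_induct) (simp_all add: act_zero act_add)

text \<open>Relations (a) and (b) for a single simple root \<open>\<beta>\<close>.\<close>

definition t_compatible :: "'e \<Rightarrow> bool" where
  "t_compatible \<beta> \<longleftrightarrow> (\<forall>\<alpha>\<in>\<Phi>. act (reflection \<beta>) (t \<alpha>) = t (reflection \<beta> \<alpha>))"

definition tau_relation :: "'e \<Rightarrow> bool" where
  "tau_relation \<beta> \<longleftrightarrow> (\<forall>x\<in>torus_lie \<Phi>.
     act (reflection \<beta>) (\<tau> x) - \<tau> (weyl_act (reflection \<beta>) x) = smul (weight_form \<beta> x) (t \<beta>))"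

text \<open>
  The connection form with the sum over the dual bases evaluated; the two agree on tangent vectors
  in the Lie algebra (\<open>connection_form_eq\<close>).
\<close>

definition \<omega> :: "('e, 'a) one_form" where
  "\<omega> h v = (\<Sum>\<alpha>\<in>\<Phi>p. smul (v \<alpha> / (h \<alpha> - 1)) (t \<alpha>)) + \<tau> v"

text \<open>
  The terms of the transformed sum are those at \<open>s\<^sub>\<beta> \<alpha>\<close>; exchanging \<open>\<beta>\<close> for \<open>-\<beta>\<close> accounts for the
  summand \<open>\<beta>(v) s\<^sub>\<beta>(t\<^sub>\<beta>)\<close>, which has no pole.
\<close>

lemma form_act_reflection:
  assumes \<beta>: "\<beta> \<in> simple_roots \<Phi>p" and h: "h \<in> torus_reg \<Phi>" and v: "v \<in> torus_lie \<Phi>"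
  shows "form_act act (reflection \<beta>) \<omega> h v - \<omega> h v =
    (\<Sum>\<alpha>\<in>\<Phi>p. smul (1 / (h \<alpha> - 1)) (smul (v \<alpha>) (act (reflection \<beta>) (t (reflection \<beta> \<alpha>)) - t \<alpha>)))
    + (smul (v \<beta>) (act (reflection \<beta>) (t \<beta>))
       + act (reflection \<beta>) (\<tau> (weyl_act (reflection \<beta>) v)) - \<tau> v)"
proof -
  let ?s = "reflection \<beta>"
  have \<beta>\<Phi>: "\<beta> \<in> \<Phi>" and s: "?s \<in> weyl_group \<Phi>"
    using \<beta> by (simp_all add: simple_root reflection_in_weyl_group)
  define F where "F \<alpha> = smul (v \<alpha> / (h \<alpha> - 1)) (act ?s (t (?s \<alpha>)))" for \<alpha>
  have "form_act act ?s \<omega> h v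
      = (\<Sum>\<alpha>\<in>\<Phi>p. F (?s \<alpha>)) + act ?s (\<tau> (weyl_act ?s v))"
    by (simp add: form_act_def pullback_def \<omega>_def F_def weyl_act_reflection act_add act_sum
        act_scale s)
  moreover have "(\<Sum>\<alpha>\<in>\<Phi>p. F (?s \<alpha>)) = (\<Sum>\<alpha>\<in>\<Phi>p. F \<alpha>) + (F (- \<beta>) - F \<beta>)"
    using sum_positive_reflection [OF \<beta>, of F] by simp
  moreover have "F (- \<beta>) - F \<beta> = smul (v \<beta>) (act ?s (t \<beta>))"
  proof -
    have h\<beta>: "h (- \<beta>) = 1 / h \<beta>" "h \<beta> \<noteq> 0" "h \<beta> \<noteq> 1"
      using h \<beta>\<Phi> root_weight [OF \<beta>\<Phi>]
      by (auto simp: torus_reg_def torus_char_def torus_minus torus_def)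
    have "v (- \<beta>) / (h (- \<beta>) - 1) - v \<beta> / (h \<beta> - 1) = v \<beta>"
      using h\<beta> torus_lie_minus [OF v root_weight [OF \<beta>\<Phi>]] by (simp add: divide_simps) algebra
    then show ?thesis
      by (simp add: F_def t_minus \<beta>\<Phi> flip: scale_left_diff_distrib)
  qed
  moreover have "(\<Sum>\<alpha>\<in>\<Phi>p. F \<alpha>) - (\<Sum>\<alpha>\<in>\<Phi>p. smul (v \<alpha> / (h \<alpha> - 1)) (t \<alpha>))
      = (\<Sum>\<alpha>\<in>\<Phi>p. smul (1 / (h \<alpha> - 1)) (smul (v \<alpha>) (act ?s (t (?s \<alpha>)) - t \<alpha>)))"
    by (simp add: F_def flip: sum_subtractf scale_right_diff_distrib)
  ultimately show ?thesis
    by (simp add: \<omega>_def algebra_simps)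
qed

text \<open>
  If \<open>s\<^sub>\<beta>\<close> fixes \<open>t\<^sub>\<beta>\<close>, the constant term is the defect of (b) at \<open>x = s\<^sub>\<beta> v\<close>.
\<close>

lemma tau_relation_iff:
  assumes \<beta>: "\<beta> \<in> simple_roots \<Phi>p" and fixed: "act (reflection \<beta>) (t \<beta>) = t \<beta>"
  shows "tau_relation \<beta> \<longleftrightarrow> (\<forall>v\<in>torus_lie \<Phi>. smul (v \<beta>) (act (reflection \<beta>) (t \<beta>))
    + act (reflection \<beta>) (\<tau> (weyl_act (reflection \<beta>) v)) - \<tau> v = 0)" (is "_ \<longleftrightarrow> (\<forall>v\<in>_. ?c v = 0)")
proof -
  let ?s = "reflection \<beta>"
  have \<beta>\<Phi>: "\<beta> \<in> \<Phi>"
    using \<beta> by (rule simple_root)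
  have c: "?c v = act ?s (\<tau> (weyl_act ?s v)) - \<tau> v - smul (weight_form \<beta> (weyl_act ?s v)) (t \<beta>)"
    if "v \<in> torus_lie \<Phi>" for v
    using torus_lie_minus [OF that root_weight [OF \<beta>\<Phi>]]
    by (simp add: weight_form_def weyl_act_reflection fixed)
  show ?thesis
  proof
    assume "tau_relation \<beta>"
    then show "\<forall>v\<in>torus_lie \<Phi>. ?c v = 0"
      using c reflection_torus_lie [OF \<beta>\<Phi>] unfolding tau_relation_def by fastforce
  next
    assume zero: "\<forall>v\<in>torus_lie \<Phi>. ?c v = 0"
    show "tau_relation \<beta>"
      unfolding tau_relation_def
    proof
      fix x assume "x \<in> torus_lie \<Phi>"
      then have sx: "weyl_act ?s x \<in> torus_lie \<Phi>"
        by (rule reflection_torus_lie [OF \<beta>\<Phi>])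
      then have "?c (weyl_act ?s x) = 0"
        using zero by blast
      then have "act ?s (\<tau> x) - \<tau> (weyl_act ?s x) - smul (weight_form \<beta> x) (t \<beta>) = 0"
        unfolding c [OF sx] by simp
      then show "act ?s (\<tau> x) - \<tau> (weyl_act ?s x) = smul (weight_form \<beta> x) (t \<beta>)"
        by (rule eq_iff_diff_eq_0 [THEN iffD2])
    qed
  qed
qed

lemma t_compatible_fixes:
  assumes "\<beta> \<in> simple_roots \<Phi>p" "t_compatible \<beta>"
  shows "act (reflection \<beta>) (t \<beta>) = t \<beta>"
  using assms simple_root [of \<beta>] by (simp add: t_compatible_def t_minus)

text \<open>Only positive roots occur in the connection; \<open>t\<^sub>-\<^sub>\<alpha> = t\<^sub>\<alpha>\<close> gives the others.\<close>

lemma t_compatibleI: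
  assumes \<beta>: "\<beta> \<in> \<Phi>"
    and pos: "\<And>\<alpha>. \<alpha> \<in> \<Phi>p \<Longrightarrow> act (reflection \<beta>) (t (reflection \<beta> \<alpha>)) = t \<alpha>"
  shows "t_compatible \<beta>"
  unfolding t_compatible_def
proof
  have all: "act (reflection \<beta>) (t (reflection \<beta> \<alpha>)) = t \<alpha>" if \<alpha>: "\<alpha> \<in> \<Phi>" for \<alpha>
    using positive_or_negative [OF \<alpha>] pos [of \<alpha>] pos [of "- \<alpha>"] \<alpha> reflection_root [OF \<beta> \<alpha>]
    by (auto simp: t_minus)
  fix \<alpha> assume "\<alpha> \<in> \<Phi>"
  then show "act (reflection \<beta>) (t \<alpha>) = t (reflection \<beta> \<alpha>)"
    using all [OF reflection_root [OF \<beta>]] by fastforce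
qed

lemma simple_equivariance_iff:
  assumes \<beta>: "\<beta> \<in> simple_roots \<Phi>p"
  shows "(\<forall>h\<in>torus_reg \<Phi>. \<forall>v\<in>torus_lie \<Phi>. form_act act (reflection \<beta>) \<omega> h v = \<omega> h v)
    \<longleftrightarrow> t_compatible \<beta> \<and> tau_relation \<beta>" (is "?equiv \<longleftrightarrow> _")
proof -
  let ?s = "reflection \<beta>"
  define a where "a v \<alpha> = smul (v \<alpha>) (act ?s (t (?s \<alpha>)) - t \<alpha>)" for v \<alpha>
  define a0 where "a0 v = smul (v \<beta>) (act ?s (t \<beta>)) + act ?s (\<tau> (weyl_act ?s v)) - \<tau> v" for v
  have \<beta>\<Phi>: "\<beta> \<in> \<Phi>"
    using \<beta> by (rule simple_root)
  have difference: "form_act act ?s \<omega> h v - \<omega> h v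
      = (\<Sum>\<alpha>\<in>\<Phi>p. smul (1 / (h \<alpha> - 1)) (a v \<alpha>)) + a0 v"
    if "h \<in> torus_reg \<Phi>" "v \<in> torus_lie \<Phi>" for h v
    using form_act_reflection [OF \<beta> that] by (simp add: a_def a0_def)
  have compatible_a: "a v \<alpha> = 0" if "t_compatible \<beta>" "\<alpha> \<in> \<Phi>p" for v \<alpha>
    using that reflection_root [OF \<beta>\<Phi> positive_root]
    by (simp add: a_def t_compatible_def)
  have tau: "tau_relation \<beta> \<longleftrightarrow> (\<forall>v\<in>torus_lie \<Phi>. a0 v = 0)" if "t_compatible \<beta>"
    using tau_relation_iff [OF \<beta> t_compatible_fixes [OF \<beta> that]] by (simp add: a0_def)
  show ?thesis
  proof
    assume equiv: ?equiv
    then have rel: "(\<Sum>\<alpha>\<in>\<Phi>p. smul (1 / (h \<alpha> - 1)) (a v \<alpha>)) + a0 v = 0"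
      if "h \<in> torus_reg \<Phi>" "v \<in> torus_lie \<Phi>" for h v
      using difference [OF that] that by simp
    have compatible: "t_compatible \<beta>"
    proof (rule t_compatibleI [OF \<beta>\<Phi>])
      fix \<alpha> assume \<alpha>: "\<alpha> \<in> \<Phi>p"
      \<comment> \<open>A tangent vector on which \<open>\<alpha>\<close> does not vanish.\<close>
      let ?v = "real_lie \<Phi> \<alpha>"
      have "a ?v \<alpha> = 0"
        by (rule polar_coefficients_zero [OF vector_space_axioms _ \<alpha>, of "a ?v" "a0 ?v"])
          (intro rel real_lie_in_torus_lie)
      moreover have "?v \<alpha> \<noteq> 0"
        using root_inner_pos [OF positive_root [OF \<alpha>]] root_weight [OF positive_root [OF \<alpha>]]
        by (simp add: real_lie_def)
      ultimately show "act ?s (t (?s \<alpha>)) = t \<alpha>"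
        by (simp add: a_def)
    qed
    obtain h where "h \<in> torus_reg \<Phi>"
      using torus_reg_nonempty by blast
    then have "a0 v = 0" if "v \<in> torus_lie \<Phi>" for v
      using rel [OF _ that] compatible_a [OF compatible] by fastforce
    then show "t_compatible \<beta> \<and> tau_relation \<beta>"
      using compatible tau by blast
  next
    assume rels: "t_compatible \<beta> \<and> tau_relation \<beta>"
    then have "form_act act ?s \<omega> h v - \<omega> h v = 0"
      if "h \<in> torus_reg \<Phi>" "v \<in> torus_lie \<Phi>" for h v
      using difference [OF that] compatible_a tau that by simp
    then show ?equiv
      by simp
  qed
qed

text \<open>The defect of equivariance of \<open>\<delta>\<close> under a simple reflection is the defect of (b).\<close>

lemma delta_map_reflection:
  assumes \<beta>: "\<beta> \<in> simple_roots \<Phi>p" and compatible: "t_compatible \<beta>" and x: "x \<in> torus_lie \<Phi>"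
  shows "act (reflection \<beta>) (delta_map \<Phi>p smul t \<tau> x)
      - delta_map \<Phi>p smul t \<tau> (weyl_act (reflection \<beta>) x)
    = act (reflection \<beta>) (\<tau> x) - \<tau> (weyl_act (reflection \<beta>) x) - smul (weight_form \<beta> x) (t \<beta>)"
proof -
  let ?s = "reflection \<beta>"
  have \<beta>\<Phi>: "\<beta> \<in> \<Phi>" and s: "?s \<in> weyl_group \<Phi>"
    using \<beta> by (simp_all add: simple_root reflection_in_weyl_group)
  define F where "F \<alpha> = smul (x (?s \<alpha>)) (t \<alpha>)" for \<alpha>
  have "act ?s (\<Sum>\<alpha>\<in>\<Phi>p. smul (x \<alpha>) (t \<alpha>)) = (\<Sum>\<alpha>\<in>\<Phi>p. F (?s \<alpha>))"
    using compatible by (simp add: F_def act_sum act_scale s t_compatible_def positive_root)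
  also have "\<dots> = (\<Sum>\<alpha>\<in>\<Phi>p. F \<alpha>) + (F (- \<beta>) - F \<beta>)"
    using sum_positive_reflection [OF \<beta>, of F] by simp
  also have "F (- \<beta>) - F \<beta> = smul (2 * x \<beta>) (t \<beta>)"
    using torus_lie_minus [OF x root_weight [OF \<beta>\<Phi>]]
    by (simp add: F_def t_minus \<beta>\<Phi> flip: scale_left_distrib)
  finally show ?thesis
    by (simp add: delta_map_def weight_form_def weyl_act_reflection F_def act_diff act_scale s
        scale_right_distrib)
qed

section \<open>From simple reflections to the Weyl group\<close>

lemma W_equivariant_connection_simple:
  "W_equivariant_connection \<Phi> act \<eta> \<longleftrightarrow>
     (\<forall>\<beta>\<in>simple_roots \<Phi>p. \<forall>h\<in>torus_reg \<Phi>. \<forall>v\<in>torus_lie \<Phi>.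
        form_act act (reflection \<beta>) \<eta> h v = \<eta> h v)" (is "_ \<longleftrightarrow> ?simple")
proof
  assume "W_equivariant_connection \<Phi> act \<eta>"
  then show ?simple
    by (simp add: W_equivariant_connection_def simple_root reflection_in_weyl_group)
next
  assume simple: ?simple
  have "\<forall>h\<in>torus_reg \<Phi>. \<forall>v\<in>torus_lie \<Phi>. form_act act w \<eta> h v = \<eta> h v"
    if "w \<in> weyl_group (simple_roots \<Phi>p)" for w
    using that
  proof induction
    case weyl_id
    show ?case
      unfolding form_act_def pullback_def inv_id act_id weyl_act_id by simp
  next
    case (weyl_reflection \<beta> w)
    let ?s = "reflection \<beta>"
    have \<beta>\<Phi>: "\<beta> \<in> \<Phi>" and s: "?s \<in> weyl_group \<Phi>" and w: "w \<in> weyl_group \<Phi>"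
      using weyl_reflection.hyps
      by (simp_all add: simple_root reflection_in_weyl_group weyl_group_simple_roots)
    have inv_act: "weyl_act (inv (?s \<circ> w)) f = weyl_act (inv w) (weyl_act ?s f)"
      for f :: "'e \<Rightarrow> complex"
    proof -
      have "inv (?s \<circ> w) = inv w \<circ> ?s"
        using o_inv_distrib [OF bij_reflection weyl_bij [OF w]] by simp
      then show ?thesis
        using weyl_act_comp [OF bij_imp_bij_inv [OF weyl_bij [OF w]] bij_reflection] by simp
    qed
    show ?case
    proof (intro ballI)
      fix h v assume h: "h \<in> torus_reg \<Phi>" and v: "v \<in> torus_lie \<Phi>"
      have "form_act act (?s \<circ> w) \<eta> h v = act ?s (form_act act w \<eta> (weyl_act ?s h) (weyl_act ?s v))"
        unfolding form_act_def pullback_def inv_act act_comp [OF s w] ..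
      also have "\<dots> = act ?s (\<eta> (weyl_act ?s h) (weyl_act ?s v))"
        using weyl_reflection.IH h v \<beta>\<Phi> by (simp add: reflection_torus_reg reflection_torus_lie)
      also have "\<dots> = \<eta> h v"
        using simple weyl_reflection.hyps(1) h v by (simp add: form_act_def pullback_def)
      finally show "form_act act (?s \<circ> w) \<eta> h v = \<eta> h v" .
    qed
  qed
  then show "W_equivariant_connection \<Phi> act \<eta>"
    by (simp add: W_equivariant_connection_def weyl_group_simple_roots)
qed

lemma W_equivariant_map_simple:
  "W_equivariant_map \<Phi> act f \<longleftrightarrow>
     (\<forall>\<beta>\<in>simple_roots \<Phi>p. \<forall>x\<in>torus_lie \<Phi>.
        act (reflection \<beta>) (f x) = f (weyl_act (reflection \<beta>) x))" (is "_ \<longleftrightarrow> ?simple")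
proof
  assume "W_equivariant_map \<Phi> act f"
  then show ?simple
    by (simp add: W_equivariant_map_def simple_root reflection_in_weyl_group)
next
  assume simple: ?simple
  have "\<forall>x\<in>torus_lie \<Phi>. act w (f x) = f (weyl_act w x)"
    if "w \<in> weyl_group (simple_roots \<Phi>p)" for w
    using that
  proof induction
    case weyl_id
    show ?case
      unfolding act_id weyl_act_id by simp
  next
    case (weyl_reflection \<beta> w)
    have s: "reflection \<beta> \<in> weyl_group \<Phi>" and w: "w \<in> weyl_group \<Phi>"
      using weyl_reflection.hyps
      by (simp_all add: simple_root reflection_in_weyl_group weyl_group_simple_roots)
    show ?case
      using simple weyl_reflection weyl_torus_lie [OF w]
      unfolding act_comp [OF s w] weyl_act_comp [OF bij_reflection weyl_bij [OF w]] by simp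
  qed
  then show "W_equivariant_map \<Phi> act f"
    by (simp add: W_equivariant_map_def weyl_group_simple_roots)
qed

lemma W_equivariant_connection_iff:
  "W_equivariant_connection \<Phi> act \<omega> \<longleftrightarrow>
     (\<forall>\<beta>\<in>simple_roots \<Phi>p. t_compatible \<beta>) \<and> (\<forall>\<beta>\<in>simple_roots \<Phi>p. tau_relation \<beta>)"
  unfolding W_equivariant_connection_simple using simple_equivariance_iff by blast

lemma W_equivariant_delta_iff:
  assumes "\<forall>\<beta>\<in>simple_roots \<Phi>p. t_compatible \<beta>"
  shows "W_equivariant_map \<Phi> act (delta_map \<Phi>p smul t \<tau>) \<longleftrightarrow>
    (\<forall>\<beta>\<in>simple_roots \<Phi>p. tau_relation \<beta>)"
proof -
  have "act (reflection \<beta>) (delta_map \<Phi>p smul t \<tau> x)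
        = delta_map \<Phi>p smul t \<tau> (weyl_act (reflection \<beta>) x) \<longleftrightarrow>
      act (reflection \<beta>) (\<tau> x) - \<tau> (weyl_act (reflection \<beta>) x) = smul (weight_form \<beta> x) (t \<beta>)"
    if "\<beta> \<in> simple_roots \<Phi>p" "x \<in> torus_lie \<Phi>" for \<beta> x
    using delta_map_reflection [OF that(1) _ that(2)] assms that(1)
    by (metis eq_iff_diff_eq_0)
  then show ?thesis
    unfolding W_equivariant_map_simple tau_relation_def by blast
qed

lemma connection_form_eq:
  assumes "dual_bases \<Phi> I ul uu" "v \<in> torus_lie \<Phi>"
  shows "connection_form \<Phi>p smul t \<tau> I ul uu h v = \<omega> h v"
  using dual_bases_sum [OF vector_space_axioms \<tau>_linear assms]
  by (simp add: connection_form_def \<omega>_def invariant_form_def weight_form_def torus_char_def)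

lemma W_equivariant_connection_form:
  assumes "dual_bases \<Phi> I ul uu"
  shows "W_equivariant_connection \<Phi> act (connection_form \<Phi>p smul t \<tau> I ul uu)
    \<longleftrightarrow> W_equivariant_connection \<Phi> act \<omega>"
  unfolding W_equivariant_connection_simple
  by (simp add: form_act_def pullback_def connection_form_eq [OF assms] reflection_torus_lie
      simple_root)

end

section \<open>Equivariance of the trigonometric connection\<close>

theorem proposition2p22:
  fixes \<Phi> \<Phi>p :: "'e::real_inner set"
    and smul :: "complex \<Rightarrow> 'a::ring \<Rightarrow> 'a"
    and act :: "('e \<Rightarrow> 'e) \<Rightarrow> 'a \<Rightarrow> 'a"
    and t :: "'e \<Rightarrow> 'a"
    and \<tau> :: "('e \<Rightarrow> complex) \<Rightarrow> 'a"
    and I :: "'i set"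
    and ul :: "'i \<Rightarrow> ('e \<Rightarrow> complex) \<Rightarrow> complex"
    and uu :: "'i \<Rightarrow> 'e \<Rightarrow> complex"
  assumes "reduced_root_system \<Phi>"
    and "positive_system \<Phi> \<Phi>p"
    and "complex_algebra smul"
    and "acts_by_algebra_automorphisms (weyl_group \<Phi>) smul act"
    and "\<And>\<alpha>. \<alpha> \<in> \<Phi> \<Longrightarrow> t (- \<alpha>) = t \<alpha>"
    and "linear_on_torus_lie \<Phi> smul \<tau>"
    and "dual_bases \<Phi> I ul uu"
  shows "(W_equivariant_connection \<Phi> act (connection_form \<Phi>p smul t \<tau> I ul uu) \<longleftrightarrow>
         (\<forall>\<beta>\<in>simple_roots \<Phi>p. \<forall>\<alpha>\<in>\<Phi>. act (reflection \<beta>) (t \<alpha>) = t (reflection \<beta> \<alpha>)) \<and>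
         (\<forall>\<beta>\<in>simple_roots \<Phi>p. \<forall>x\<in>torus_lie \<Phi>.
            act (reflection \<beta>) (\<tau> x) - \<tau> (weyl_act (reflection \<beta>) x)
              = smul (weight_form \<beta> x) (t \<beta>))) \<and>
     ((\<forall>\<beta>\<in>simple_roots \<Phi>p. \<forall>\<alpha>\<in>\<Phi>. act (reflection \<beta>) (t \<alpha>) = t (reflection \<beta> \<alpha>)) \<longrightarrow>
        ((\<forall>\<beta>\<in>simple_roots \<Phi>p. \<forall>x\<in>torus_lie \<Phi>.
            act (reflection \<beta>) (\<tau> x) - \<tau> (weyl_act (reflection \<beta>) x)
              = smul (weight_form \<beta> x) (t \<beta>)) \<longleftrightarrow>
         W_equivariant_map \<Phi> act (delta_map \<Phi>p smul t \<tau>)))"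
proof -
  interpret complex_algebra smul
    by (rule assms(3))
  interpret weyl_algebra \<Phi> \<Phi>p smul act t \<tau>
    by unfold_locales (fact assms)+
  show ?thesis
    using W_equivariant_connection_iff W_equivariant_delta_iff
    unfolding W_equivariant_connection_form [OF assms(7)] t_compatible_def tau_relation_def
    by blast
qed

end
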